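(* Let $\sigma$ be a smooth, (symmetric,) strictly convex norm on $\mathbb{R}^n$ with unit sphere $\Sigma=\{x\in\mathbb{R}^n:\sigma(x)=1\}$. For a closed convex cone $C\subseteq\mathbb{R}^n$ let $P_C$ be the $\sigma$-projection onto $C$ and $R_C=I-P_C$. The following assertions are equivalent: (i) $P_C$ and $R_C$ are mutually polar retractions on convex cones for every closed convex cone $C\subseteq\mathbb{R}^n$; (ii) $\ker(P_C)=\{x\in\mathbb{R}^n:P_Cx=0\}$ is convex for every closed convex cone $C\subseteq\mathbb{R}^n$; (iii) $P_C$ is convex additive on $R_C(\mathbb{R}^n)$ for every closed convex cone $C\subseteq\mathbb{R}^n$; (iv) all the meridians of $\Sigma$ are coherent; (v) $P_\omega$ and $R_\omega=I-P_\omega$ are mutually polar retractions on convex cones for each minimal wedge $\omega\subseteq\mathbb{R}^n$.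
   Context: $\mathbb{R}^n$ carries the standard inner product $\langle\cdot,\cdot\rangle$ and Euclidean norm $\|\cdot\|$; $I$ is the identity mapping. A norm $\sigma$ is strictly convex if its unit sphere $\Sigma$ contains no line segment (of positive length), and smooth if at each $x\in\Sigma$ there is exactly one supporting hyperplane of the unit ball; then $\nabla x=\nabla_\Sigma x$ denotes the Euclidean unit outward normal to $\Sigma$ at $x$, i.e. the unique $a$ with $\|a\|=1$ and $\langle a,z\rangle\le\langle a,x\rangle$ for all $z\in\Sigma$. A convex cone is a nonempty set closed under addition and under multiplication by scalars $\lambda\ge0$. The $\sigma$-projection onto a closed convex cone $C$ is $P_Cx=\operatorname{argmin}\{\sigma(x-y):y\in C\}$ (the unique minimizer). A retraction is a continuous mapping $Q:\mathbb{R}^n\to\mathbb{R}^n$ with $Q0=0$ and $Q\circ Q=Q$. Mappings $P,R:\mathbb{R}^n\to\mathbb{R}^n$ are mutually polar retractions if both are retractions and $P+R=I$; they are mutually polar retractions on convex cones if in addition both ranges $P(\mathbb{R}^n)$ and $R(\mathbb{R}^n)$ are convex cones. A mapping $A:\mathbb{R}^n\to\mathbb{R}^n$ is convex additive on a set $M$ if $A(tx+(1-t)y)=tAx+(1-t)Ay$ for all $x,y\in M$ and $t\in[0,1]$ (the set $M$ is not assumed to be convex in (iii)). A meridian of $\Sigma$ is a set $\Sigma\cap D$ with $D$ a two-dimensional linear subspace of $\mathbb{R}^n$. A meridian (or an arc $\gamma$ on a meridian) $\gamma$ is coherent if $\dim\operatorname{span}\{\nabla_\Sigma x:x\in\gamma\}=2$.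 A minimal wedge is a set $\omega=H^1_-\cap H^2_-$, where $H^i=\{x:\langle a_i,x\rangle=0\}$, $H^i_-=\{x:\langle a_i,x\rangle\le0\}$, $\|a_i\|=1$ ($i=1,2$), and $H^1\ne H^2$. *)

theory Defs
  imports "HOL-Analysis.Analysis"
begin

text \<open>A norm \<open>\<sigma>\<close> on the space is a function, unrelated to the Euclidean \<open>norm\<close> of the type class.
  Absolute homogeneity includes symmetry.\<close>

definition is_norm :: "('a::real_vector \<Rightarrow> real) \<Rightarrow> bool" where
  "is_norm \<sigma> \<longleftrightarrow>
     (\<forall>x. 0 \<le> \<sigma> x) \<and> (\<forall>x. \<sigma> x = 0 \<longleftrightarrow> x = 0) \<and>
     (\<forall>c x. \<sigma> (c *\<^sub>R x) = \<bar>c\<bar> * \<sigma> x) \<and> (\<forall>x y. \<sigma> (x + y) \<le> \<sigma> x + \<sigma> y)"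

definition unit_sphere :: "('a \<Rightarrow> real) \<Rightarrow> 'a set" where
  "unit_sphere \<sigma> = {x. \<sigma> x = 1}"

definition unit_ball :: "('a \<Rightarrow> real) \<Rightarrow> 'a set" where
  "unit_ball \<sigma> = {x. \<sigma> x \<le> 1}"

definition strictly_convex_norm :: "('a::real_vector \<Rightarrow> real) \<Rightarrow> bool" where
  "strictly_convex_norm \<sigma> \<longleftrightarrow>
     (\<forall>a b. closed_segment a b \<subseteq> unit_sphere \<sigma> \<longrightarrow> a = b)"

definition supporting_hyperplane :: "'a::real_inner set \<Rightarrow> 'a \<Rightarrow> 'a set \<Rightarrow> bool" where
  "supporting_hyperplane B x H \<longleftrightarrow>
     (\<exists>a b. a \<noteq> 0 \<and> H = {z. a \<bullet> z = b} \<and> x \<in> H \<and> B \<subseteq> {z. a \<bullet> z \<le> b})"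

definition smooth_norm :: "('a::real_inner \<Rightarrow> real) \<Rightarrow> bool" where
  "smooth_norm \<sigma> \<longleftrightarrow>
     (\<forall>x\<in>unit_sphere \<sigma>. \<exists>!H. supporting_hyperplane (unit_ball \<sigma>) x H)"

text \<open>The description below determines a vector when \<open>\<sigma>\<close> is a smooth norm and \<open>x\<close> lies on its
  unit sphere; \<open>unit_normal\<close> is only used there.\<close>

definition unit_normal :: "('a::real_inner \<Rightarrow> real) \<Rightarrow> 'a \<Rightarrow> 'a" where
  "unit_normal \<sigma> x = (THE a. norm a = 1 \<and> (\<forall>z\<in>unit_sphere \<sigma>. a \<bullet> z \<le> a \<bullet> x))"

text \<open>For a strictly convex norm and a nonempty closed convex set \<open>C\<close> the minimizer exists and is
  unique, so the choice made by \<open>arg_min_on\<close> is immaterial.\<close>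

definition proj :: "('a::ab_group_add \<Rightarrow> real) \<Rightarrow> 'a set \<Rightarrow> 'a \<Rightarrow> 'a" where
  "proj \<sigma> C x = arg_min_on (\<lambda>y. \<sigma> (x - y)) C"

definition coproj :: "('a::ab_group_add \<Rightarrow> real) \<Rightarrow> 'a set \<Rightarrow> 'a \<Rightarrow> 'a" where
  "coproj \<sigma> C x = x - proj \<sigma> C x"

text \<open>Not the library's \<open>retraction\<close>, which is relative to a target set and does not fix the
  origin.\<close>

definition zero_retraction :: "('a::real_normed_vector \<Rightarrow> 'a) \<Rightarrow> bool" where
  "zero_retraction Q \<longleftrightarrow> continuous_on UNIV Q \<and> Q 0 = 0 \<and> Q \<circ> Q = Q"

definition mutually_polar_retractions ::
    "('a::real_normed_vector \<Rightarrow> 'a) \<Rightarrow> ('a \<Rightarrow> 'a) \<Rightarrow> bool" where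
  "mutually_polar_retractions P R \<longleftrightarrow>
     zero_retraction P \<and> zero_retraction R \<and> (\<forall>x. P x + R x = x)"

definition mutually_polar_retractions_on_convex_cones ::
    "('a::real_normed_vector \<Rightarrow> 'a) \<Rightarrow> ('a \<Rightarrow> 'a) \<Rightarrow> bool" where
  "mutually_polar_retractions_on_convex_cones P R \<longleftrightarrow>
     mutually_polar_retractions P R \<and> convex_cone (range P) \<and> convex_cone (range R)"

text \<open>The set \<open>M\<close> need not be convex.\<close>

definition convex_additive_on :: "'a::real_vector set \<Rightarrow> ('a \<Rightarrow> 'a) \<Rightarrow> bool" where
  "convex_additive_on M A \<longleftrightarrow>
     (\<forall>x\<in>M. \<forall>y\<in>M. \<forall>t\<in>{0..1}.
        A (t *\<^sub>R x + (1 - t) *\<^sub>R y) = t *\<^sub>R A x + (1 - t) *\<^sub>R A y)"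

definition meridian :: "('a::euclidean_space \<Rightarrow> real) \<Rightarrow> 'a set \<Rightarrow> bool" where
  "meridian \<sigma> \<gamma> \<longleftrightarrow> (\<exists>D. subspace D \<and> dim D = 2 \<and> \<gamma> = unit_sphere \<sigma> \<inter> D)"

definition coherent :: "('a::euclidean_space \<Rightarrow> real) \<Rightarrow> 'a set \<Rightarrow> bool" where
  "coherent \<sigma> \<gamma> \<longleftrightarrow> dim (span (unit_normal \<sigma> ` \<gamma>)) = 2"

definition minimal_wedge :: "'a::real_inner set \<Rightarrow> bool" where
  "minimal_wedge \<omega> \<longleftrightarrow>
     (\<exists>a1 a2. norm a1 = 1 \<and> norm a2 = 1 \<and> {x. a1 \<bullet> x = 0} \<noteq> {x. a2 \<bullet> x = 0} \<and>
        \<omega> = {x. a1 \<bullet> x \<le> 0} \<inter> {x. a2 \<bullet> x \<le> 0})"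

end

theory Submission
  imports Defs
begin

text \<open>The proof runs through the duality map \<open>J\<close>, the gradient of \<open>\<sigma>\<^sup>2 / 2\<close>: the vector \<open>J x\<close> is a
  nonnegative multiple of the unit normal at \<open>x / \<sigma> x\<close>, scaled so that \<open>J\<close> is homogeneous for all
  real factors. Smoothness makes \<open>J\<close> single-valued and hence continuous, strict convexity makes it
  injective.

  First, all the assertions about projections concern the kernel of \<open>P\<^sub>C\<close>. For a closed convex cone
  \<open>C\<close> the range of \<open>R\<^sub>C\<close> is exactly this kernel (\<open>range_coproj\<close>), and everything else that polar
  retractions on convex cones require holds for every \<open>C\<close>. So, cone by cone, the
  retraction property and convex additivity both say that \<open>ker P\<^sub>C\<close> is convex. Moreover \<open>ker P\<^sub>C\<close> is the preimage under \<open>J\<close> of the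
  polar cone of \<open>C\<close> (\<open>proj_eq_0_iff\<close>).

  Second, coherence of all meridians says that \<open>J\<close> maps planes into planes. As \<open>J\<close> preserves linear
  independence of pairs and is homogeneous, this is the condition
  \<open>J (x + y) \<in> span {J x, J y}\<close>, called \<open>planar\<close> below.

  The two sides meet as follows. If \<open>J\<close> is planar, then the coefficients of \<open>J (x + y)\<close> with respect
  to \<open>J x\<close> and \<open>J y\<close> are nonnegative: on the path \<open>x + t y\<close> the coefficient of \<open>J x\<close> starts at \<open>1\<close>,
  varies continuously, and by injectivity cannot vanish, since otherwise \<open>J (x + t y)\<close> would be a
  multiple of \<open>J y\<close>. Hence \<open>J x\<close> and \<open>J y\<close> in the polar cone force \<open>J (x + y)\<close> into it, for every
  \<open>C\<close>. Conversely, convexity of the kernel for the minimal wedge with normals \<open>J x\<close> and \<open>J y\<close>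
  already gives planarity: \<open>x\<close> and \<open>y\<close> lie in that kernel, therefore so does \<open>(x + y) / 2\<close>, and a
  functional that is nonpositive on the wedge is a combination of the two normals.\<close>

section \<open>Linear independence of pairs and continuity from closed graphs\<close>

lemma notin_span_singleton_sym:
  fixes x y :: "'a::real_vector"
  assumes "y \<noteq> 0" "x \<notin> span {y}"
  shows "x \<noteq> 0" "y \<notin> span {x}"
proof -
  show "x \<noteq> 0" using assms by (auto simp: span_zero)
  then show "y \<notin> span {x}"
    using assms in_span_insert[of y x "{}"] by auto
qed

lemma span_pairE:
  fixes x y :: "'a::real_vector"
  assumes "u \<in> span {x, y}"
  obtains p q where "u = p *\<^sub>R x + q *\<^sub>R y"
proof -
  from assms obtain p where "u - p *\<^sub>R x \<in> span {y}" by (auto simp: span_breakdown_eq[of u x])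
  then obtain q where "u - p *\<^sub>R x = q *\<^sub>R y" by (auto simp: span_singleton)
  then have "u = p *\<^sub>R x + q *\<^sub>R y" by (simp add: algebra_simps)
  then show ?thesis using that by blast
qed

lemma dim_span_pair:
  fixes x y :: "'a::euclidean_space"
  assumes "y \<noteq> 0" "x \<notin> span {y}"
  shows "dim (span {x, y}) = 2"
proof -
  have "x \<noteq> y" using assms by (auto simp: span_base)
  moreover have "independent {x, y}"
    using assms by (auto simp: independent_insert)
  ultimately have "dim {x, y} = 2" by (simp add: dim_eq_card_independent)
  then show ?thesis by simp
qed

lemma subspace_dim_2E:
  fixes D :: "'a::euclidean_space set"
  assumes "subspace D" "dim D = 2"
  obtains x y where "y \<noteq> 0" "x \<notin> span {y}" "D = span {x, y}"
proof -
  obtain B where B: "B \<subseteq> D" "independent B" "D \<subseteq> span B" "card B = dim D"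
    using basis_exists by blast
  then obtain x y where xy: "B = {x, y}" "x \<noteq> y" using assms by (auto simp: card_2_iff)
  have "D = span {x, y}"
    using B assms xy by (metis span_minimal subset_antisym)
  moreover have "y \<noteq> 0" "x \<notin> span {y}" using B(2) xy by (auto simp: independent_insert)
  ultimately show ?thesis using that by blast
qed

text \<open>The linear bound makes the values over a bounded set bounded, so that compactness turns a closed
  graph into continuity. Both the duality map and the projections are described by closed
  conditions on pairs, and their continuity rests on this.\<close>

lemma continuous_on_UNIV_closed_graph:
  fixes f :: "'a::euclidean_space \<Rightarrow> 'b::euclidean_space"
  assumes clo: "closed {(x, f x) | x. True}"
    and bound: "\<And>x. norm (f x) \<le> M * norm x" and "0 \<le> M"
  shows "continuous_on UNIV f"
proof -
  have "isCont f x" for x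
  proof -
    have "continuous_on (cball x 1) f"
    proof (rule continuous_from_closed_graph)
      show "compact (cball (0::'b) (M * (norm x + 1)))" by simp
      show "f \<in> cball x 1 \<rightarrow> cball 0 (M * (norm x + 1))"
      proof
        fix y assume "y \<in> cball x 1"
        then have "norm (y - x) \<le> 1" by (simp add: dist_norm norm_minus_commute)
        then have "norm y \<le> norm x + 1" using norm_triangle_sub[of y x] by simp
        then have "M * norm y \<le> M * (norm x + 1)" using \<open>0 \<le> M\<close> by (rule mult_left_mono)
        then show "f y \<in> cball 0 (M * (norm x + 1))" using bound[of y] by simp
      qed
      have "(\<lambda>y. (y, f y)) ` cball x 1 = {(x, f x) | x. True} \<inter> (cball x 1 \<times> UNIV)"
        by auto
      then show "closed ((\<lambda>y. (y, f y)) ` cball x 1)"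
        using clo by (simp add: closed_Int closed_Times)
    qed
    then show ?thesis
      by (rule continuous_on_interior) simp
  qed
  then show ?thesis by (simp add: continuous_at_imp_continuous_on)
qed

section \<open>Norms on Euclidean space\<close>

locale norm_on_euclidean =
  fixes \<sigma> :: "'a::euclidean_space \<Rightarrow> real"
  assumes is_norm: "is_norm \<sigma>"
begin

lemma nonneg: "0 \<le> \<sigma> x"
  and eq_0_iff: "\<sigma> x = 0 \<longleftrightarrow> x = 0"
  and scale: "\<sigma> (c *\<^sub>R x) = \<bar>c\<bar> * \<sigma> x"
  and triangle: "\<sigma> (x + y) \<le> \<sigma> x + \<sigma> y"
  using is_norm unfolding is_norm_def by auto

lemma zero [simp]: "\<sigma> 0 = 0" by (simp add: eq_0_iff)

lemma pos: "x \<noteq> 0 \<Longrightarrow> 0 < \<sigma> x"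
  using nonneg[of x] eq_0_iff[of x] by simp

lemma minus: "\<sigma> (- x) = \<sigma> x"
  using scale[of "-1" x] by simp

lemma minus_commute: "\<sigma> (x - y) = \<sigma> (y - x)"
  using minus[of "x - y"] by simp

lemma convex_on_sigma: "convex_on UNIV \<sigma>"
proof (rule convex_onI)
  fix t :: real and x y
  assume "0 < t" "t < 1"
  then show "\<sigma> ((1 - t) *\<^sub>R x + t *\<^sub>R y) \<le> (1 - t) * \<sigma> x + t * \<sigma> y"
    using triangle[of "(1 - t) *\<^sub>R x" "t *\<^sub>R y"] by (simp add: scale)
qed simp

lemma continuous_on_sigma: "continuous_on UNIV \<sigma>"
  using convex_on_continuous[OF _ convex_on_sigma] by simp

lemma continuous_intro [continuous_intros]:
  "continuous_on S f \<Longrightarrow> continuous_on S (\<lambda>x. \<sigma> (f x))"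
  by (rule continuous_on_compose2[OF continuous_on_sigma]) auto

text \<open>Compactness of the Euclidean sphere and homogeneity make \<open>\<sigma>\<close> equivalent to the Euclidean norm.\<close>

lemma sphere_minimum: "\<exists>u\<in>sphere 0 1. \<forall>x. \<sigma> u * norm x \<le> \<sigma> x"
  and sphere_maximum: "\<exists>v\<in>sphere 0 1. \<forall>x. \<sigma> x \<le> \<sigma> v * norm x"
proof -
  have ne: "sphere (0::'a) 1 \<noteq> {}" by simp
  have co: "continuous_on (sphere 0 1) \<sigma>"
    by (rule continuous_on_subset[OF continuous_on_sigma]) simp
  obtain u where u: "u \<in> sphere 0 1" "\<And>y. y \<in> sphere 0 1 \<Longrightarrow> \<sigma> u \<le> \<sigma> y"
    using continuous_attains_inf[OF compact_sphere ne co] by blast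
  obtain v where v: "v \<in> sphere 0 1" "\<And>y. y \<in> sphere 0 1 \<Longrightarrow> \<sigma> y \<le> \<sigma> v"
    using continuous_attains_sup[OF compact_sphere ne co] by blast
  have "\<sigma> u * norm x \<le> \<sigma> x \<and> \<sigma> x \<le> \<sigma> v * norm x" for x
  proof (cases "x = 0")
    case False
    then have "sgn x \<in> sphere 0 1" by (simp add: norm_sgn)
    moreover have "\<sigma> x = \<sigma> (sgn x) * norm x"
      using scale[of "norm x" "sgn x"] False by (simp add: sgn_div_norm del: scaleR_scaleR) (simp add: mult.commute)
    ultimately show ?thesis using u(2) v(2) by (simp add: mult_right_mono)
  qed simp
  then show "\<exists>u\<in>sphere 0 1. \<forall>x. \<sigma> u * norm x \<le> \<sigma> x"
    "\<exists>v\<in>sphere 0 1. \<forall>x. \<sigma> x \<le> \<sigma> v * norm x"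
    using u(1) v(1) by blast+
qed

lemma le_norm: obtains M where "0 < M" "\<And>x. \<sigma> x \<le> M * norm x"
proof -
  obtain v where v: "v \<in> sphere 0 1" "\<forall>x. \<sigma> x \<le> \<sigma> v * norm x"
    using sphere_maximum by blast
  show ?thesis
  proof (rule that)
    show "0 < \<sigma> v" using v(1) by (intro pos) auto
  qed (use v(2) in blast)
qed

lemma norm_le: obtains m where "0 < m" "\<And>x. norm x \<le> m * \<sigma> x"
proof -
  obtain u where u: "u \<in> sphere 0 1" "\<forall>x. \<sigma> u * norm x \<le> \<sigma> x"
    using sphere_minimum by blast
  have "0 < \<sigma> u" using u(1) by (intro pos) auto
  show ?thesis
  proof (rule that)
    show "0 < inverse (\<sigma> u)" using \<open>0 < \<sigma> u\<close> by simp
    show "norm x \<le> inverse (\<sigma> u) * \<sigma> x" for x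
      using u(2)[rule_format, of x] \<open>0 < \<sigma> u\<close> by (simp add: field_simps)
  qed
qed

text \<open>The duality relation of \<open>\<sigma>\<close>: the vector \<open>a\<close> is a subgradient of \<open>\<sigma>\<^sup>2 / 2\<close> at \<open>x\<close>. In this
  normalization the relation is homogeneous and has a closed graph, also at the origin.\<close>

definition dual_pair :: "'a \<Rightarrow> 'a \<Rightarrow> bool" where
  "dual_pair x a \<longleftrightarrow> a \<bullet> x = (\<sigma> x)\<^sup>2 \<and> (\<forall>z. a \<bullet> z \<le> \<sigma> x * \<sigma> z)"

lemma dual_pair_scale:
  assumes "dual_pair x a"
  shows "dual_pair (c *\<^sub>R x) (c *\<^sub>R a)"
proof -
  have "(c *\<^sub>R a) \<bullet> z \<le> \<sigma> (c *\<^sub>R x) * \<sigma> z" for z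
  proof -
    have "(c *\<^sub>R a) \<bullet> z = a \<bullet> (c *\<^sub>R z)" by simp
    also have "\<dots> \<le> \<sigma> x * \<sigma> (c *\<^sub>R z)" using assms unfolding dual_pair_def by blast
    finally show ?thesis by (simp add: scale mult_ac)
  qed
  moreover have "(c *\<^sub>R a) \<bullet> (c *\<^sub>R x) = (\<sigma> (c *\<^sub>R x))\<^sup>2"
    using assms by (simp add: dual_pair_def scale power_mult_distrib) (simp add: power2_eq_square)
  ultimately show ?thesis unfolding dual_pair_def by blast
qed

lemma dual_pair_0: "dual_pair 0 a \<longleftrightarrow> a = 0"
proof
  assume "dual_pair 0 a"
  then have "a \<bullet> a \<le> 0" by (simp add: dual_pair_def)
  then show "a = 0" by (metis inner_ge_zero inner_eq_zero_iff order_antisym)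
qed (simp add: dual_pair_def)

lemma dual_pair_unit_iff:
  assumes "\<sigma> x = 1"
  shows "dual_pair x a \<longleftrightarrow> a \<bullet> x = 1 \<and> unit_ball \<sigma> \<subseteq> {z. a \<bullet> z \<le> 1}"
proof
  assume "dual_pair x a"
  then show "a \<bullet> x = 1 \<and> unit_ball \<sigma> \<subseteq> {z. a \<bullet> z \<le> 1}"
    using assms by (auto simp: dual_pair_def unit_ball_def intro: order_trans)
next
  assume a: "a \<bullet> x = 1 \<and> unit_ball \<sigma> \<subseteq> {z. a \<bullet> z \<le> 1}"
  have "a \<bullet> z \<le> \<sigma> z" for z
  proof (cases "z = 0")
    case False
    have "inverse (\<sigma> z) *\<^sub>R z \<in> unit_ball \<sigma>"
      using pos[OF False] by (simp add: unit_ball_def scale)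
    then have "a \<bullet> (inverse (\<sigma> z) *\<^sub>R z) \<le> 1" using a by blast
    then show ?thesis using pos[OF False] by (simp add: field_simps)
  qed simp
  then show "dual_pair x a" using a assms by (simp add: dual_pair_def)
qed

text \<open>The unit ball has the origin in its interior, so a supporting hyperplane cannot pass through
  the origin and has a unique equation with right-hand side \<open>1\<close>.\<close>

lemma supporting_hyperplane_iff_dual_pair:
  assumes x: "\<sigma> x = 1"
  shows "supporting_hyperplane (unit_ball \<sigma>) x H \<longleftrightarrow> (\<exists>a. dual_pair x a \<and> H = {z. a \<bullet> z = 1})"
proof
  assume "supporting_hyperplane (unit_ball \<sigma>) x H"
  then obtain a b where ab: "a \<noteq> 0" "H = {z. a \<bullet> z = b}" "a \<bullet> x = b"
    and ball: "unit_ball \<sigma> \<subseteq> {z. a \<bullet> z \<le> b}"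
    unfolding supporting_hyperplane_def by auto
  have b: "0 < b"
  proof -
    have "inverse (\<sigma> a) *\<^sub>R a \<in> unit_ball \<sigma>"
      using pos[OF ab(1)] by (simp add: unit_ball_def scale)
    then have "inverse (\<sigma> a) * (a \<bullet> a) \<le> b" using ball by auto
    moreover have "0 < inverse (\<sigma> a) * (a \<bullet> a)"
      using ab(1) pos[OF ab(1)] by (intro mult_pos_pos) simp_all
    ultimately show ?thesis by linarith
  qed
  have "dual_pair x (inverse b *\<^sub>R a)"
    unfolding dual_pair_unit_iff[OF x] using ab(3) ball b by (auto simp: field_simps)
  moreover have "H = {z. (inverse b *\<^sub>R a) \<bullet> z = 1}" using ab(2) b by (auto simp: field_simps)
  ultimately show "\<exists>a. dual_pair x a \<and> H = {z. a \<bullet> z = 1}" by blast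
next
  assume "\<exists>a. dual_pair x a \<and> H = {z. a \<bullet> z = 1}"
  then obtain a where "a \<bullet> x = 1" "unit_ball \<sigma> \<subseteq> {z. a \<bullet> z \<le> 1}" "H = {z. a \<bullet> z = 1}"
    using dual_pair_unit_iff[OF x] by blast
  then show "supporting_hyperplane (unit_ball \<sigma>) x H"
    unfolding supporting_hyperplane_def by (intro exI[of _ a] exI[of _ 1]) auto
qed

end

text \<open>The equation with right-hand side \<open>1\<close> is determined by the hyperplane, so uniqueness of the
  supporting hyperplane becomes uniqueness of the dual vector.\<close>

lemma hyperplane_level_1_inject:
  fixes a a' x :: "'a::real_inner"
  assumes eq: "{z. a \<bullet> z = 1} = {z. a' \<bullet> z = 1}" and x: "a \<bullet> x = 1"
  shows "a = a'"
proof -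
  have *: "a' \<bullet> z = 1" if "a \<bullet> z = 1" for z
    using that equalityD1[OF eq] by auto
  have "a \<bullet> z = a' \<bullet> z" for z
  proof (cases "a \<bullet> z = 0")
    case True
    then have "a' \<bullet> (x + z) = 1" using x by (intro *) (simp add: inner_add_right)
    then show ?thesis using *[OF x] True by (simp add: inner_add_right)
  next
    case False
    then have "a' \<bullet> (inverse (a \<bullet> z) *\<^sub>R z) = 1" by (intro *) simp
    then show ?thesis using False by (simp add: field_simps)
  qed
  then show ?thesis by (metis vector_eq_rdot)
qed

section \<open>The duality map\<close>

locale smooth_rotund_norm = norm_on_euclidean +
  assumes smooth: "smooth_norm \<sigma>" and rotund: "strictly_convex_norm \<sigma>"
begin

text \<open>On the unit sphere this is smoothness, which also provides the existence of a supporting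
  hyperplane; homogeneity extends it to all vectors.\<close>

lemma dual_pair_ex1: "\<exists>!a. dual_pair x a"
proof -
  have unit: "\<exists>!a. dual_pair x a" if x: "\<sigma> x = 1" for x
  proof -
    have ex1: "\<exists>!H. supporting_hyperplane (unit_ball \<sigma>) x H"
      using smooth x by (simp add: smooth_norm_def unit_sphere_def)
    then obtain H where "supporting_hyperplane (unit_ball \<sigma>) x H" by (rule ex1E)
    then obtain a where a: "dual_pair x a"
      unfolding supporting_hyperplane_iff_dual_pair[OF x] by (elim exE conjE)
    have supp: "supporting_hyperplane (unit_ball \<sigma>) x {z. b \<bullet> z = 1}" if "dual_pair x b" for b
      unfolding supporting_hyperplane_iff_dual_pair[OF x] using that by (intro exI conjI) simp_all
    have "a' = a" if a': "dual_pair x a'" for a'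
    proof (rule hyperplane_level_1_inject)
      show "{z. a' \<bullet> z = 1} = {z. a \<bullet> z = 1}"
        using ex1 supp[OF a] supp[OF a'] by (metis (no_types))
      show "a' \<bullet> x = 1" using a' x by (simp add: dual_pair_def)
    qed
    with a show ?thesis by (rule ex1I)
  qed
  show ?thesis
  proof (cases "x = 0")
    case True
    then show ?thesis by (simp add: dual_pair_0)
  next
    case False
    define s where "s = \<sigma> x"
    have s: "0 < s" unfolding s_def by (rule pos[OF False])
    have "\<sigma> (inverse s *\<^sub>R x) = 1" using s by (simp add: scale flip: s_def)
    note ex1 = unit[OF this]
    then obtain a where a: "dual_pair (inverse s *\<^sub>R x) a" by (rule ex1E)
    have u: "b = a" if "dual_pair (inverse s *\<^sub>R x) b" for b
      using ex1 a that by (metis (no_types))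
    have "dual_pair x (s *\<^sub>R a)" using dual_pair_scale[OF a, of s] s by simp
    moreover have "b = s *\<^sub>R a" if "dual_pair x b" for b
      using u[OF dual_pair_scale[OF that, of "inverse s"], symmetric] s by simp
    ultimately show ?thesis by (rule ex1I)
  qed
qed

definition J :: "'a \<Rightarrow> 'a" where "J x = (THE a. dual_pair x a)"

lemma dual_pair_iff: "dual_pair x a \<longleftrightarrow> a = J x"
  unfolding J_def using dual_pair_ex1[of x] by (metis theI')

lemma dual_pair_J: "dual_pair x (J x)"
  by (simp add: dual_pair_iff)

lemma J_self: "J x \<bullet> x = (\<sigma> x)\<^sup>2"
  using dual_pair_J unfolding dual_pair_def by blast

lemma J_le: "J x \<bullet> z \<le> \<sigma> x * \<sigma> z"
  using dual_pair_J unfolding dual_pair_def by blast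

lemma J_scale: "J (c *\<^sub>R x) = c *\<^sub>R J x"
  using dual_pair_scale[of x "J x" c] by (simp add: dual_pair_iff)

lemma J_zero [simp]: "J 0 = 0"
  using J_scale[of 0 0] by simp

lemma J_eq_0_iff [simp]: "J x = 0 \<longleftrightarrow> x = 0"
  using J_self[of x] eq_0_iff[of x] by auto

lemma J_continuous: "continuous_on UNIV J"
proof -
  obtain M where M: "0 < M" "\<And>x. \<sigma> x \<le> M * norm x" using le_norm by blast
  have bound: "norm (J x) \<le> M\<^sup>2 * norm x" for x
  proof (cases "J x = 0")
    case False
    have "norm (J x) * norm (J x) = J x \<bullet> J x" by (simp add: dot_square_norm power2_eq_square)
    also have "\<dots> \<le> \<sigma> x * \<sigma> (J x)" by (rule J_le)
    also have "\<dots> \<le> (M * norm x) * (M * norm (J x))"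
      using M nonneg by (intro mult_mono) (auto intro: mult_nonneg_nonneg less_imp_le)
    also have "\<dots> = (M\<^sup>2 * norm x) * norm (J x)" by (simp add: power2_eq_square)
    finally show ?thesis using False by simp
  qed simp
  have "{(x, J x) | x. True} = {p. snd p \<bullet> fst p = (\<sigma> (fst p))\<^sup>2} \<inter>
      (\<Inter>z. {p. snd p \<bullet> z \<le> \<sigma> (fst p) * \<sigma> z})"
    (is "?G = ?R")
  proof (rule set_eqI)
    fix z :: "'a \<times> 'a"
    have "z \<in> ?G \<longleftrightarrow> dual_pair (fst z) (snd z)" by (cases z) (auto simp: dual_pair_iff)
    also have "\<dots> \<longleftrightarrow> z \<in> ?R" by (simp add: dual_pair_def)
    finally show "z \<in> ?G \<longleftrightarrow> z \<in> ?R" .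
  qed
  moreover have "closed \<dots>"
    by (intro closed_Int closed_INT ballI closed_Collect_eq closed_Collect_le continuous_intros)
  ultimately show ?thesis
    using continuous_on_UNIV_closed_graph[of J "M\<^sup>2"] bound by simp
qed

text \<open>Strict convexity, transferred from the unit sphere to spheres of every radius.\<close>

lemma segment_constant_imp_eq:
  assumes "\<And>u. u \<in> closed_segment a b \<Longrightarrow> \<sigma> u = d"
  shows "a = b"
proof (cases "d = 0")
  case True
  then show ?thesis using assms[of a] assms[of b] by (simp add: eq_0_iff)
next
  case False
  moreover have "0 \<le> d" using assms[of a] nonneg[of a] by simp
  ultimately have d: "0 < d" by simp
  have "closed_segment (inverse d *\<^sub>R a) (inverse d *\<^sub>R b) \<subseteq> unit_sphere \<sigma>"
    using assms d by (auto simp: closed_segment_linear_image[OF linear_scale_self] unit_sphere_def scale)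
  then have "inverse d *\<^sub>R a = inverse d *\<^sub>R b"
    using rotund unfolding strictly_convex_norm_def by blast
  then show ?thesis using d by simp
qed

lemma sigma_segment_le:
  assumes "u \<in> closed_segment a b" "\<sigma> a \<le> d" "\<sigma> b \<le> d"
  shows "\<sigma> u \<le> d"
proof -
  obtain t where t: "0 \<le> t" "t \<le> 1" "u = (1 - t) *\<^sub>R a + t *\<^sub>R b"
    using assms(1) by (auto simp: in_segment)
  then have "\<sigma> u \<le> (1 - t) * \<sigma> a + t * \<sigma> b" using convex_on_sigma by (auto simp: convex_on_def)
  also have "\<dots> \<le> d" using t assms by (intro convex_bound_le) auto
  finally show ?thesis .
qed

text \<open>If \<open>u\<close> and \<open>v\<close> share their dual vector, they have the same norm \<open>s\<close>, and that vector takes the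
  value \<open>s\<^sup>2\<close> on the whole segment between them; this forces the norm to be \<open>s\<close> along the segment.\<close>

lemma J_inject: "J u = J v \<longleftrightarrow> u = v"
proof
  assume eq: "J u = J v"
  have le: "\<sigma> y \<le> \<sigma> x" if "J x = J y" for x y
  proof (cases "y = 0")
    case False
    have "\<sigma> y * \<sigma> y \<le> \<sigma> x * \<sigma> y" using J_self[of y] J_le[of x y] that by (simp add: power2_eq_square)
    then show ?thesis using pos[OF False] by simp
  qed (simp add: nonneg)
  define s where "s = \<sigma> u"
  have s: "\<sigma> u = s" "\<sigma> v = s" using le eq unfolding s_def by (auto intro: antisym)
  have "\<sigma> w = s" if w: "w \<in> closed_segment u v" for w
  proof (rule antisym)
    show "\<sigma> w \<le> s" using sigma_segment_le[OF w] s by simp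
    have "J u \<bullet> w = s * s"
    proof -
      obtain t where "w = (1 - t) *\<^sub>R u + t *\<^sub>R v" using w by (auto simp: in_segment)
      moreover have "J u \<bullet> u = s * s" "J u \<bullet> v = s * s"
        using J_self[of u] J_self[of v] eq s by (simp_all add: power2_eq_square)
      ultimately show ?thesis by (simp only: inner_add_right inner_scaleR_right) (simp add: algebra_simps)
    qed
    then have "s * s \<le> s * \<sigma> w" using J_le[of u w] s by simp
    then show "s \<le> \<sigma> w" using nonneg[of w] nonneg[of u] s by (cases "s = 0") auto
  qed
  then show "u = v" by (rule segment_constant_imp_eq)
qed simp

lemma J_notin_span:
  assumes "x \<notin> span {y}"
  shows "J x \<notin> span {J y}"
proof
  assume "J x \<in> span {J y}"
  then obtain c where "J x = J (c *\<^sub>R y)" by (auto simp: span_singleton J_scale)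
  then have "x = c *\<^sub>R y" by (simp add: J_inject)
  then show False using assms by (auto simp: span_singleton)
qed

lemma J_add_dependent:
  assumes "y = 0 \<or> x \<in> span {y}"
  shows "J (x + y) = J x + J y"
proof (cases "y = 0")
  case False
  then obtain c where x: "x = c *\<^sub>R y" using assms by (auto simp: span_singleton)
  have "J (c *\<^sub>R y + y) = J ((c + 1) *\<^sub>R y)" by (simp add: algebra_simps)
  also have "\<dots> = (c + 1) *\<^sub>R J y" by (rule J_scale)
  finally show ?thesis using x by (simp add: J_scale scaleR_add_left)
qed simp

section \<open>Projections\<close>

text \<open>Existence is compactness of the part of \<open>C\<close> that is at least as close to \<open>x\<close> as some given
  point. Two nearest points would span a segment in \<open>C\<close> of constant distance to \<open>x\<close>,
  which strict convexity excludes.\<close>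

lemma proj_ex1:
  assumes "closed C" "convex C" "C \<noteq> {}"
  shows "\<exists>!p. p \<in> C \<and> (\<forall>c\<in>C. \<sigma> (x - p) \<le> \<sigma> (x - c))"
proof (rule ex_ex1I)
  obtain c0 where c0: "c0 \<in> C" using assms by blast
  obtain m where m: "0 < m" "\<And>x. norm x \<le> m * \<sigma> x" using norm_le by blast
  define K where "K = C \<inter> {y. \<sigma> (x - y) \<le> \<sigma> (x - c0)}"
  have "closed K" unfolding K_def
    by (intro closed_Int assms closed_Collect_le continuous_intros)
  moreover have "K \<subseteq> cball x (m * \<sigma> (x - c0))"
  proof
    fix y assume "y \<in> K"
    then have "\<sigma> (x - y) \<le> \<sigma> (x - c0)" by (simp add: K_def)
    then have "m * \<sigma> (x - y) \<le> m * \<sigma> (x - c0)" using m by simp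
    then show "y \<in> cball x (m * \<sigma> (x - c0))" using m(2)[of "x - y"] by (simp add: dist_norm)
  qed
  ultimately have "compact K" using bounded_subset compact_eq_bounded_closed by blast
  moreover have "c0 \<in> K" using c0 by (simp add: K_def)
  moreover have "continuous_on K (\<lambda>y. \<sigma> (x - y))" by (intro continuous_intros)
  ultimately obtain p where p: "p \<in> K" "\<And>y. y \<in> K \<Longrightarrow> \<sigma> (x - p) \<le> \<sigma> (x - y)"
    using continuous_attains_inf[of K "\<lambda>y. \<sigma> (x - y)"] by blast
  have "\<sigma> (x - p) \<le> \<sigma> (x - c)" if "c \<in> C" for c
    using p that by (cases "c \<in> K") (auto simp: K_def)
  then show "\<exists>p. p \<in> C \<and> (\<forall>c\<in>C. \<sigma> (x - p) \<le> \<sigma> (x - c))" using p by (auto simp: K_def)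
next
  fix p q
  assume p: "p \<in> C \<and> (\<forall>c\<in>C. \<sigma> (x - p) \<le> \<sigma> (x - c))"
    and q: "q \<in> C \<and> (\<forall>c\<in>C. \<sigma> (x - q) \<le> \<sigma> (x - c))"
  have eq: "\<sigma> (x - q) = \<sigma> (x - p)" using p q by (simp add: antisym)
  have "x - p = x - q"
  proof (rule segment_constant_imp_eq)
    fix u assume u: "u \<in> closed_segment (x - p) (x - q)"
    have "x - u \<in> closed_segment p q"
      using u by (auto simp: in_segment algebra_simps)
    then have "x - u \<in> C" using closed_segment_subset[of p C q] p q assms by blast
    then have "\<sigma> (x - p) \<le> \<sigma> u" using p by fastforce
    then show "\<sigma> u = \<sigma> (x - p)" using sigma_segment_le[OF u, of "\<sigma> (x - p)"] eq by simp
  qed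
  then show "p = q" by simp
qed

lemma proj_eq_iff:
  assumes "closed C" "convex C" "C \<noteq> {}"
  shows "proj \<sigma> C x = p \<longleftrightarrow> p \<in> C \<and> (\<forall>c\<in>C. \<sigma> (x - p) \<le> \<sigma> (x - c))"
proof -
  let ?min = "\<lambda>p. p \<in> C \<and> (\<forall>c\<in>C. \<sigma> (x - p) \<le> \<sigma> (x - c))"
  have "proj \<sigma> C x = (SOME p. ?min p)"
    by (simp add: proj_def arg_min_on_def arg_min_def is_arg_min_linorder Ball_def)
  moreover have "?min (SOME p. ?min p)"
    by (rule someI_ex) (rule ex1_implies_ex[OF proj_ex1[OF assms]])
  ultimately have min: "?min (proj \<sigma> C x)" by simp
  show ?thesis
  proof
    assume "?min p"
    then have "p = (THE p. ?min p)" by (rule the1_equality[OF proj_ex1[OF assms], symmetric])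
    moreover have "proj \<sigma> C x = (THE p. ?min p)"
      using the1_equality[OF proj_ex1[OF assms] min] by (rule sym)
    ultimately show "proj \<sigma> C x = p" by simp
  qed (use min in simp)
qed

lemma proj_continuous:
  assumes C: "closed C" "convex_cone C"
  shows "continuous_on UNIV (proj \<sigma> C)"
proof -
  have C': "closed C" "convex C" "C \<noteq> {}" "0 \<in> C"
    using C by (auto simp: convex_cone_def convex_cone_contains_0)
  obtain m where m: "0 < m" "\<And>x. norm x \<le> m * \<sigma> x" using norm_le by blast
  obtain M where M: "0 < M" "\<And>x. \<sigma> x \<le> M * norm x" using le_norm by blast
  have bound: "norm (proj \<sigma> C x) \<le> (2 * m * M) * norm x" for x
  proof -
    have "\<sigma> (x - proj \<sigma> C x) \<le> \<sigma> x"
      using proj_eq_iff[OF C'(1-3), of x "proj \<sigma> C x"] C'(4) by fastforce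
    then have "\<sigma> (proj \<sigma> C x) \<le> 2 * \<sigma> x"
      using triangle[of "proj \<sigma> C x - x" x] minus_commute[of x "proj \<sigma> C x"] by simp
    also have "\<dots> \<le> 2 * (M * norm x)" using M by simp
    finally have "m * \<sigma> (proj \<sigma> C x) \<le> m * (2 * (M * norm x))" using m by simp
    then show ?thesis using m(2)[of "proj \<sigma> C x"] by (simp add: mult_ac)
  qed
  have "{(x, proj \<sigma> C x) | x. True} =
      (UNIV \<times> C) \<inter> (\<Inter>c\<in>C. {p. \<sigma> (fst p - snd p) \<le> \<sigma> (fst p - c)})"
    (is "?G = ?R")
  proof (rule set_eqI)
    fix z :: "'a \<times> 'a"
    have "z \<in> ?G \<longleftrightarrow> proj \<sigma> C (fst z) = snd z" by (cases z) auto
    also have "\<dots> \<longleftrightarrow> z \<in> ?R"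
      unfolding proj_eq_iff[OF C'(1-3)] by (cases z) simp
    finally show "z \<in> ?G \<longleftrightarrow> z \<in> ?R" .
  qed
  moreover have "closed \<dots>"
    by (intro closed_Int closed_INT ballI closed_Times C closed_UNIV closed_Collect_le continuous_intros)
  ultimately show ?thesis
    using continuous_on_UNIV_closed_graph[of "proj \<sigma> C" "2 * m * M"] bound m M by simp
qed

text \<open>The kernel of the projection is the preimage under \<open>J\<close> of the polar cone of \<open>C\<close>. If \<open>0\<close> is
  nearest to \<open>x\<close>, then comparing \<open>x\<close> with \<open>x - t c\<close> bounds \<open>J\<close> at \<open>x - t c\<close>, not at \<open>x\<close>; letting \<open>t\<close> tend to
  \<open>0\<close> uses the continuity of \<open>J\<close>.\<close>

lemma proj_eq_0_iff:
  assumes C: "closed C" "convex_cone C"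
  shows "proj \<sigma> C x = 0 \<longleftrightarrow> (\<forall>c\<in>C. J x \<bullet> c \<le> 0)"
proof -
  have C': "closed C" "convex C" "C \<noteq> {}" "0 \<in> C"
    using C by (auto simp: convex_cone_def convex_cone_contains_0)
  have "proj \<sigma> C x = 0 \<longleftrightarrow> (\<forall>c\<in>C. \<sigma> x \<le> \<sigma> (x - c))"
    using proj_eq_iff[OF C'(1-3), of x 0] C' by simp
  also have "\<dots> \<longleftrightarrow> (\<forall>c\<in>C. J x \<bullet> c \<le> 0)"
  proof (intro iffI ballI)
    fix c assume J: "\<forall>c\<in>C. J x \<bullet> c \<le> 0" and c: "c \<in> C"
    have "\<sigma> x * \<sigma> x \<le> J x \<bullet> (x - c)"
      using J c J_self[of x] by (simp add: inner_diff_right power2_eq_square)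
    also have "\<dots> \<le> \<sigma> x * \<sigma> (x - c)" by (rule J_le)
    finally show "\<sigma> x \<le> \<sigma> (x - c)"
      using pos[of x] by (cases "x = 0") (auto simp: nonneg)
  next
    fix c assume min: "\<forall>c\<in>C. \<sigma> x \<le> \<sigma> (x - c)" and c: "c \<in> C"
    have neg: "J (x - t *\<^sub>R c) \<bullet> c \<le> 0" if t: "0 < t" for t
    proof -
      let ?y = "x - t *\<^sub>R c"
      have "\<sigma> x \<le> \<sigma> ?y" using min c t convex_cone_scaleR[OF C(2)] by simp
      have "J ?y \<bullet> x \<le> \<sigma> ?y * \<sigma> x" by (rule J_le)
      also have "\<dots> \<le> \<sigma> ?y * \<sigma> ?y" using \<open>\<sigma> x \<le> \<sigma> ?y\<close> nonneg by (rule mult_left_mono)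
      also have "\<dots> = J ?y \<bullet> ?y" using J_self[of ?y] by (simp add: power2_eq_square)
      also have "\<dots> = J ?y \<bullet> x - t * (J ?y \<bullet> c)" by (simp add: inner_diff_right)
      finally show ?thesis using t by (simp add: mult_le_0_iff)
    qed
    have "continuous_on UNIV (\<lambda>t. J (x - t *\<^sub>R c) \<bullet> c)"
      by (intro continuous_intros continuous_on_compose2[OF J_continuous]) auto
    then have "isCont (\<lambda>t. J (x - t *\<^sub>R c) \<bullet> c) 0"
      by (simp add: continuous_on_eq_continuous_at)
    then have "((\<lambda>t. J (x - t *\<^sub>R c) \<bullet> c) \<longlongrightarrow> J x \<bullet> c) (at_right 0)"
      by (simp add: isCont_def filterlim_at_split)
    moreover have "\<forall>\<^sub>F t in at_right 0. J (x - t *\<^sub>R c) \<bullet> c \<le> 0"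
      using neg by (auto simp: eventually_at_right_field intro: exI[of _ 1])
    ultimately show "J x \<bullet> c \<le> 0"
      by (metis tendsto_upperbound trivial_limit_at_right_real)
  qed
  finally show ?thesis .
qed

text \<open>If \<open>p\<close> is nearest to \<open>x\<close>, then \<open>0\<close> is nearest to \<open>x - p\<close>, because \<open>p + C\<close> is contained in \<open>C\<close>.\<close>

lemma range_coproj:
  assumes C: "closed C" "convex_cone C"
  shows "range (coproj \<sigma> C) = {x. proj \<sigma> C x = 0}"
proof -
  have C': "closed C" "convex C" "C \<noteq> {}" "0 \<in> C"
    using C by (auto simp: convex_cone_def convex_cone_contains_0)
  note proj = proj_eq_iff[OF C'(1-3)]
  have "proj \<sigma> C (coproj \<sigma> C x) = 0" for x
  proof -
    let ?p = "proj \<sigma> C x"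
    have p: "?p \<in> C" "\<And>c. c \<in> C \<Longrightarrow> \<sigma> (x - ?p) \<le> \<sigma> (x - c)" using proj[of x ?p] by auto
    have "\<sigma> (x - ?p) \<le> \<sigma> (x - ?p - c)" if "c \<in> C" for c
      using p(2)[OF convex_cone_add[OF C(2) p(1) that]] by (simp add: diff_diff_eq)
    then show ?thesis using C' by (simp add: proj coproj_def)
  qed
  moreover have "x \<in> range (coproj \<sigma> C)" if "proj \<sigma> C x = 0" for x
    using that by (intro image_eqI[of _ _ x]) (simp_all add: coproj_def)
  ultimately show ?thesis by auto
qed

text \<open>Continuity, idempotence and the range of the projection are automatic, and the range of \<open>R\<^sub>C\<close> is the
  kernel, which is closed under nonnegative scaling. Only its convexity is at stake.\<close>

lemma polar_on_convex_cones_iff: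
  assumes C: "closed C" "convex_cone C"
  shows "mutually_polar_retractions_on_convex_cones (proj \<sigma> C) (coproj \<sigma> C)
    \<longleftrightarrow> convex {x. proj \<sigma> C x = 0}"
proof -
  have C': "closed C" "convex C" "C \<noteq> {}" "0 \<in> C"
    using C by (auto simp: convex_cone_def convex_cone_contains_0)
  note proj = proj_eq_iff[OF C'(1-3)]
  have in_C: "proj \<sigma> C x \<in> C" for x using proj by blast
  have fix_C: "proj \<sigma> C x = x" if "x \<in> C" for x using that by (simp add: proj nonneg)
  have cont: "continuous_on UNIV (proj \<sigma> C)" by (rule proj_continuous[OF C])
  have "range (proj \<sigma> C) = C" using in_C fix_C by (force intro: sym)
  moreover have "zero_retraction (proj \<sigma> C)"
    using cont in_C fix_C C'(4) by (auto simp: zero_retraction_def)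
  moreover have "zero_retraction (coproj \<sigma> C)"
  proof -
    have "continuous_on UNIV (coproj \<sigma> C)"
      unfolding coproj_def by (intro continuous_intros cont)
    moreover have "coproj \<sigma> C (coproj \<sigma> C x) = coproj \<sigma> C x" for x
      using range_coproj[OF C] by (auto simp: coproj_def[of _ _ "coproj \<sigma> C x"])
    ultimately show ?thesis
      using fix_C C'(4) by (auto simp: zero_retraction_def coproj_def)
  qed
  moreover have "convex_cone {x. proj \<sigma> C x = 0} \<longleftrightarrow> convex {x. proj \<sigma> C x = 0}"
  proof -
    have "conic {x. proj \<sigma> C x = 0}"
      unfolding conic_def by (auto simp: proj_eq_0_iff[OF C] J_scale mult_nonneg_nonpos)
    then show ?thesis using fix_C C'(4) by (auto simp: convex_cone_def)
  qed
  ultimately show ?thesis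
    using C unfolding mutually_polar_retractions_on_convex_cones_def mutually_polar_retractions_def
    by (simp add: range_coproj[OF C]) (simp add: coproj_def)
qed

text \<open>On the range of \<open>R\<^sub>C\<close> the projection vanishes, so convex additivity says that it also vanishes on
  segments between points of this range.\<close>

lemma convex_additive_on_range_coproj_iff:
  assumes C: "closed C" "convex_cone C"
  shows "convex_additive_on (range (coproj \<sigma> C)) (proj \<sigma> C) \<longleftrightarrow> convex {x. proj \<sigma> C x = 0}"
proof
  assume "convex_additive_on (range (coproj \<sigma> C)) (proj \<sigma> C)"
  then have "proj \<sigma> C (t *\<^sub>R x + (1 - t) *\<^sub>R y) = 0"
    if "proj \<sigma> C x = 0" "proj \<sigma> C y = 0" "0 \<le> t" "t \<le> 1" for x y t
    using that by (simp add: convex_additive_on_def range_coproj[OF C])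
  then show "convex {x. proj \<sigma> C x = 0}"
    by (intro convexI) (metis (mono_tags, lifting) add_diff_cancel_left' le_add_same_cancel1 mem_Collect_eq)
next
  assume "convex {x. proj \<sigma> C x = 0}"
  then show "convex_additive_on (range (coproj \<sigma> C)) (proj \<sigma> C)"
    unfolding convex_additive_on_def range_coproj[OF C]
    by (auto dest: convexD[where u = t and v = "1 - t" for t])
qed

section \<open>Coherence\<close>

text \<open>The algebraic form of coherence: \<open>J\<close> maps two-dimensional subspaces into two-dimensional
  subspaces (see \<open>planar_span\<close> below).\<close>

definition planar :: bool where
  "planar \<longleftrightarrow> (\<forall>x y. J (x + y) \<in> span {J x, J y})"

lemma planar_span:
  assumes planar "u \<in> span {x, y}"
  shows "J u \<in> span {J x, J y}"
proof -
  obtain p q where u: "u = p *\<^sub>R x + q *\<^sub>R y" using assms(2) by (rule span_pairE)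
  have "J u \<in> span {p *\<^sub>R J x, q *\<^sub>R J y}"
    using assms(1) u unfolding planar_def by (metis J_scale)
  also have "\<dots> \<subseteq> span {J x, J y}"
    by (intro span_minimal) (auto intro: span_scale span_base)
  finally show ?thesis .
qed

text \<open>A vector that attains its maximum over the unit sphere at \<open>x\<close> becomes dual to \<open>x\<close> after division by
  this positive maximum, hence is a positive multiple of \<open>J x\<close>.\<close>

lemma unit_normal_eq:
  assumes x: "\<sigma> x = 1"
  shows "unit_normal \<sigma> x = inverse (norm (J x)) *\<^sub>R J x"
  unfolding unit_normal_def
proof (rule the_equality)
  let ?n = "norm (J x)"
  have "x \<noteq> 0" using x by auto
  then have n: "0 < ?n" by simp
  have "J x \<bullet> z \<le> J x \<bullet> x" if "\<sigma> z = 1" for z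
    using J_le[of x z] J_self[of x] x that by simp
  then show "norm (inverse ?n *\<^sub>R J x) = 1 \<and>
      (\<forall>z\<in>unit_sphere \<sigma>. (inverse ?n *\<^sub>R J x) \<bullet> z \<le> (inverse ?n *\<^sub>R J x) \<bullet> x)"
    using n by (auto simp: unit_sphere_def intro!: mult_left_mono)
  fix a assume a: "norm a = 1 \<and> (\<forall>z\<in>unit_sphere \<sigma>. a \<bullet> z \<le> a \<bullet> x)"
  have le: "a \<bullet> z \<le> (a \<bullet> x) * \<sigma> z" for z
  proof (cases "z = 0")
    case False
    have "inverse (\<sigma> z) *\<^sub>R z \<in> unit_sphere \<sigma>"
      using pos[OF False] by (simp add: unit_sphere_def scale)
    then have "a \<bullet> (inverse (\<sigma> z) *\<^sub>R z) \<le> a \<bullet> x" using a by blast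
    then show ?thesis using pos[OF False] by (simp add: field_simps)
  qed simp
  have b: "0 < a \<bullet> x"
  proof -
    have "a \<noteq> 0" using a by auto
    have "0 < a \<bullet> a" using \<open>a \<noteq> 0\<close> by simp
    also have "\<dots> \<le> (a \<bullet> x) * \<sigma> a" by (rule le)
    finally show ?thesis using pos[OF \<open>a \<noteq> 0\<close>] by (simp add: zero_less_mult_iff)
  qed
  have "dual_pair x (inverse (a \<bullet> x) *\<^sub>R a)"
    unfolding dual_pair_def using x b le by (auto simp: field_simps)
  then have "J x = inverse (a \<bullet> x) *\<^sub>R a" by (simp add: dual_pair_iff)
  moreover from this have "?n = inverse (a \<bullet> x)" using a b by simp
  ultimately show "a = inverse ?n *\<^sub>R J x" using b by simp
qed

lemma span_unit_normal_meridian: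
  assumes D: "subspace D"
  shows "span (unit_normal \<sigma> ` (unit_sphere \<sigma> \<inter> D)) = span (J ` D)"
proof (intro antisym span_minimal subspace_span)
  show "unit_normal \<sigma> ` (unit_sphere \<sigma> \<inter> D) \<subseteq> span (J ` D)"
    by (auto simp: unit_sphere_def unit_normal_eq intro: span_scale span_base)
  show "J ` D \<subseteq> span (unit_normal \<sigma> ` (unit_sphere \<sigma> \<inter> D))"
  proof
    fix a assume "a \<in> J ` D"
    then obtain x where x: "x \<in> D" "a = J x" by blast
    show "a \<in> span (unit_normal \<sigma> ` (unit_sphere \<sigma> \<inter> D))"
    proof (cases "x = 0")
      case False
      define u where "u = inverse (\<sigma> x) *\<^sub>R x"
      have u: "\<sigma> u = 1" "u \<in> D" "x = \<sigma> x *\<^sub>R u"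
        using pos[OF False] x(1) D by (auto simp: u_def scale subspace_scale)
      have "u \<noteq> 0" using u(1) by auto
      then have "J u = norm (J u) *\<^sub>R unit_normal \<sigma> u" by (simp add: unit_normal_eq[OF u(1)])
      moreover have "a = \<sigma> x *\<^sub>R J u" using x(2) u(3) J_scale by metis
      ultimately have "a = (\<sigma> x * norm (J u)) *\<^sub>R unit_normal \<sigma> u" by (metis scaleR_scaleR)
      moreover have "unit_normal \<sigma> u \<in> unit_normal \<sigma> ` (unit_sphere \<sigma> \<inter> D)"
        using u by (simp add: unit_sphere_def)
      ultimately show ?thesis by (metis span_base span_scale)
    qed (simp add: x span_zero)
  qed
qed

text \<open>For independent \<open>x\<close> and \<open>y\<close> the image of their plane contains the independent vectors \<open>J x\<close> and
  \<open>J y\<close>. So the image of the plane spans a space of dimension at least two, with equality exactly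
  if this space is \<open>span {J x, J y}\<close>.\<close>

lemma coherent_meridians_iff_planar:
  "(\<forall>\<gamma>. meridian \<sigma> \<gamma> \<longrightarrow> coherent \<sigma> \<gamma>) \<longleftrightarrow> planar"
proof
  assume coh: "\<forall>\<gamma>. meridian \<sigma> \<gamma> \<longrightarrow> coherent \<sigma> \<gamma>"
  show planar unfolding planar_def
  proof (intro allI)
    fix x y
    show "J (x + y) \<in> span {J x, J y}"
    proof (cases "y = 0 \<or> x \<in> span {y}")
      case True
      then show ?thesis by (simp add: J_add_dependent span_add span_base)
    next
      case False
      define D where "D = span {x, y}"
      have D: "subspace D" "dim D = 2" "x \<in> D" "y \<in> D" "x + y \<in> D"
        using dim_span_pair[of y x] False by (auto simp: D_def span_base span_add simp del: dim_span)
      then have "coherent \<sigma> (unit_sphere \<sigma> \<inter> D)" using coh unfolding meridian_def by blast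
      then have "dim (span (J ` D)) = 2"
        unfolding coherent_def span_unit_normal_meridian[OF D(1)] .
      moreover have "dim (span {J x, J y}) = 2"
        using False by (intro dim_span_pair J_notin_span) auto
      moreover have "span {J x, J y} \<subseteq> span (J ` D)"
        using D by (intro span_mono) auto
      ultimately have "span {J x, J y} = span (J ` D)"
        by (intro subspace_dim_equal) auto
      then show ?thesis using D by (simp add: span_base)
    qed
  qed
next
  assume planar
  show "\<forall>\<gamma>. meridian \<sigma> \<gamma> \<longrightarrow> coherent \<sigma> \<gamma>"
  proof (intro allI impI)
    fix \<gamma> assume "meridian \<sigma> \<gamma>"
    then obtain D where D: "subspace D" "dim D = 2" "\<gamma> = unit_sphere \<sigma> \<inter> D"
      unfolding meridian_def by blast
    obtain x y where xy: "y \<noteq> 0" "x \<notin> span {y}" "D = span {x, y}"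
      using subspace_dim_2E[OF D(1,2)] by blast
    have "J ` D \<subseteq> span {J x, J y}" using planar_span[OF \<open>planar\<close>] xy(3) by blast
    moreover have "{J x, J y} \<subseteq> J ` D" using xy(3) by (auto simp: span_base)
    ultimately have "span (J ` D) = span {J x, J y}"
      by (metis antisym span_minimal span_mono subspace_span)
    moreover have "dim (span {J x, J y}) = 2"
      using xy by (intro dim_span_pair J_notin_span) auto
    ultimately show "coherent \<sigma> \<gamma>"
      unfolding coherent_def D(3) span_unit_normal_meridian[OF D(1)] by simp
  qed
qed

text \<open>The intermediate value argument: were \<open>\<alpha>\<close> negative, the coefficient of \<open>J x\<close> would vanish
  somewhere on the way from \<open>x\<close> to \<open>x + y\<close>. There \<open>J\<close> is parallel to \<open>J y\<close>, and injectivity makes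
  \<open>x\<close> a multiple of \<open>y\<close>.\<close>

lemma J_add_coefficient_nonneg:
  assumes ind: "y \<noteq> 0" "x \<notin> span {y}" and planar
    and eq: "J (x + y) = \<alpha> *\<^sub>R J x + \<beta> *\<^sub>R J y"
  shows "0 \<le> \<alpha>"
proof (rule ccontr)
  assume "\<not> 0 \<le> \<alpha>"
  \<comment> \<open>The component of \<open>J x\<close> orthogonal to \<open>J y\<close>; pairing with it reads off the sign of the
    coefficient of \<open>J x\<close>.\<close>
  define w where "w = J x - ((J x \<bullet> J y) / (J y \<bullet> J y)) *\<^sub>R J y"
  have "J y \<bullet> J y \<noteq> 0" using ind by simp
  then have wy: "w \<bullet> J y = 0" by (simp add: w_def inner_diff_left)
  have "w \<noteq> 0"
    using J_notin_span[OF ind(2)] by (auto simp: w_def span_singleton)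
  moreover have "w \<bullet> w = w \<bullet> J x"
    using wy by (subst (2) w_def) (simp add: inner_diff_right)
  ultimately have wx: "0 < w \<bullet> J x" by (metis inner_gt_zero_iff)
  define h where "h t = w \<bullet> J (x + t *\<^sub>R y)" for t
  have "continuous_on {0..1} h"
    unfolding h_def by (intro continuous_intros continuous_on_compose2[OF J_continuous]) auto
  moreover have "0 \<le> h 0" using wx by (simp add: h_def)
  moreover have "h 1 \<le> 0"
    using eq wy wx \<open>\<not> 0 \<le> \<alpha>\<close> by (simp add: h_def inner_add_right mult_nonpos_nonneg)
  ultimately obtain t where t: "h t = 0" using IVT2'[of h 1 0 0] by auto
  have "x + t *\<^sub>R y \<in> span {x, y}" by (intro span_add span_scale) (auto intro: span_base)
  then obtain p q where pq: "J (x + t *\<^sub>R y) = p *\<^sub>R J x + q *\<^sub>R J y"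
    using planar_span[OF \<open>planar\<close>] span_pairE by metis
  then have "p = 0" using t wx wy by (simp add: h_def inner_add_right)
  then have "J (x + t *\<^sub>R y) = J (q *\<^sub>R y)" using pq by (simp add: J_scale)
  then have "x = (q - t) *\<^sub>R y" by (simp add: J_inject algebra_simps)
  then show False using ind(2) by (auto simp: span_singleton)
qed

lemma J_add_nonneg_combination:
  assumes planar
  obtains \<alpha> \<beta> where "0 \<le> \<alpha>" "0 \<le> \<beta>" "J (x + y) = \<alpha> *\<^sub>R J x + \<beta> *\<^sub>R J y"
proof (cases "y = 0 \<or> x \<in> span {y}")
  case True
  then show ?thesis using that[of 1 1] by (simp add: J_add_dependent)
next
  case False
  obtain \<alpha> \<beta> where eq: "J (x + y) = \<alpha> *\<^sub>R J x + \<beta> *\<^sub>R J y"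
    using assms span_pairE unfolding planar_def by metis
  have "0 \<le> \<alpha>" using J_add_coefficient_nonneg[OF _ _ assms eq] False by blast
  moreover have "0 \<le> \<beta>"
  proof (rule J_add_coefficient_nonneg[OF _ _ assms])
    show "x \<noteq> 0" "y \<notin> span {x}" using notin_span_singleton_sym[of y x] False by auto
    show "J (y + x) = \<beta> *\<^sub>R J y + \<alpha> *\<^sub>R J x" using eq by (simp add: add.commute)
  qed
  ultimately show ?thesis using that eq by blast
qed

text \<open>The polar cone of \<open>C\<close> is closed under nonnegative combinations.\<close>

lemma planar_imp_convex_kernel:
  assumes planar and C: "closed C" "convex_cone C"
  shows "convex {x. proj \<sigma> C x = 0}"
proof -
  have "x + y \<in> {x. proj \<sigma> C x = 0}"
    if "x \<in> {x. proj \<sigma> C x = 0}" "y \<in> {x. proj \<sigma> C x = 0}" for x y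
  proof -
    obtain \<alpha> \<beta> where "0 \<le> \<alpha>" "0 \<le> \<beta>" "J (x + y) = \<alpha> *\<^sub>R J x + \<beta> *\<^sub>R J y"
      using J_add_nonneg_combination[OF \<open>planar\<close>] by blast
    then show ?thesis
      using that
      by (auto simp: proj_eq_0_iff[OF C] inner_add_left intro!: add_nonpos_nonpos mult_nonneg_nonpos)
  qed
  then show ?thesis
    by (auto simp: convex_def proj_eq_0_iff[OF C] J_scale mult_nonneg_nonpos)
qed

end

section \<open>Minimal wedges\<close>

lemma minimal_wedge_closed_convex_cone:
  assumes "minimal_wedge \<omega>"
  shows "closed \<omega>" "convex_cone \<omega>"
proof -
  obtain a b where \<omega>: "\<omega> = {x. a \<bullet> x \<le> 0} \<inter> {x. b \<bullet> x \<le> 0}"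
    using assms unfolding minimal_wedge_def by blast
  show "closed \<omega>" unfolding \<omega> by (intro closed_Int closed_halfspace_le)
  show "convex_cone \<omega>"
    using convex_cone_halfspace_le[of a] convex_cone_halfspace_le[of b]
    unfolding \<omega> convex_cone_iff by blast
qed

lemma minimal_wedgeI:
  fixes a b :: "'a::euclidean_space"
  assumes "b \<noteq> 0" "a \<notin> span {b}"
  shows "minimal_wedge ({x. a \<bullet> x \<le> 0} \<inter> {x. b \<bullet> x \<le> 0})"
proof -
  have "a \<noteq> 0" using assms notin_span_singleton_sym by blast
  \<comment> \<open>If the hyperplanes agreed, the component of \<open>a\<close> orthogonal to \<open>b\<close> would be orthogonal to \<open>a\<close>
    as well, hence zero.\<close>
  have ne: "{x. sgn a \<bullet> x = 0} \<noteq> {x. sgn b \<bullet> x = 0}"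
  proof
    assume eq: "{x. sgn a \<bullet> x = 0} = {x. sgn b \<bullet> x = 0}"
    define u where "u = a - ((a \<bullet> b) / (b \<bullet> b)) *\<^sub>R b"
    have "b \<bullet> u = 0" using assms(1) by (simp add: u_def inner_diff_right inner_commute)
    moreover from this have "a \<bullet> u = 0"
      using eq assms(1) \<open>a \<noteq> 0\<close> by (auto simp: sgn_div_norm set_eq_iff)
    ultimately have "u \<bullet> u = 0" by (subst (1) u_def) (simp add: inner_diff_left)
    then have "a \<in> span {b}" by (auto simp: u_def span_singleton)
    then show False using assms(2) by blast
  qed
  have "{x. a \<bullet> x \<le> 0} = {x. sgn a \<bullet> x \<le> 0}" "{x. b \<bullet> x \<le> 0} = {x. sgn b \<bullet> x \<le> 0}"
    using \<open>a \<noteq> 0\<close> \<open>b \<noteq> 0\<close> by (auto simp: sgn_div_norm mult_le_0_iff)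
  then show ?thesis
    unfolding minimal_wedge_def using ne \<open>a \<noteq> 0\<close> \<open>b \<noteq> 0\<close>
    by (intro exI[of _ "sgn a"] exI[of _ "sgn b"]) (simp add: norm_sgn)
qed

text \<open>The component of \<open>v\<close> orthogonal to \<open>a\<close> and \<open>b\<close> is itself an admissible test vector.\<close>

lemma in_span_pair_if_orthogonal:
  fixes a b v :: "'a::euclidean_space"
  assumes "\<And>w. a \<bullet> w = 0 \<Longrightarrow> b \<bullet> w = 0 \<Longrightarrow> v \<bullet> w \<le> 0"
  shows "v \<in> span {a, b}"
proof -
  obtain y z where yz: "y \<in> span {a, b}" "\<And>w. w \<in> span {a, b} \<Longrightarrow> orthogonal z w" "v = y + z"
    using orthogonal_subspace_decomp_exists by metis
  have az: "a \<bullet> z = 0" "b \<bullet> z = 0"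
    using yz(2)[of a] yz(2)[of b] by (simp_all add: span_base orthogonal_def inner_commute)
  moreover have "y \<bullet> z = 0" using yz(1,2) by (simp add: orthogonal_def inner_commute)
  ultimately have "z \<bullet> z \<le> 0" using assms[of z] yz(3) by (simp add: inner_add_left)
  then have "z = 0" by (metis inner_gt_zero_iff linorder_not_less)
  then show ?thesis using yz by simp
qed

context smooth_rotund_norm
begin

text \<open>The wedge with normals \<open>J x\<close> and \<open>J y\<close> is chosen so that its kernel contains \<open>x\<close> and \<open>y\<close>. It
  contains every \<open>w\<close> that is orthogonal to both normals, and there \<open>J (x + y)\<close> is nonpositive.\<close>

lemma convex_wedge_kernels_imp_planar:
  assumes "\<And>\<omega>. minimal_wedge \<omega> \<Longrightarrow> convex {x. proj \<sigma> \<omega> x = 0}"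
  shows planar
  unfolding planar_def
proof (intro allI)
  fix x y
  show "J (x + y) \<in> span {J x, J y}"
  proof (cases "y = 0 \<or> x \<in> span {y}")
    case True
    then show ?thesis by (simp add: J_add_dependent span_add span_base)
  next
    case False
    define \<omega> where "\<omega> = {w. J x \<bullet> w \<le> 0} \<inter> {w. J y \<bullet> w \<le> 0}"
    have \<omega>: "minimal_wedge \<omega>"
      unfolding \<omega>_def using False by (intro minimal_wedgeI J_notin_span) auto
    note C = minimal_wedge_closed_convex_cone[OF \<omega>]
    let ?K = "{x. proj \<sigma> \<omega> x = 0}"
    have "x \<in> ?K" "y \<in> ?K" unfolding mem_Collect_eq proj_eq_0_iff[OF C] by (simp_all add: \<omega>_def)
    then have "(1/2) *\<^sub>R x + (1/2) *\<^sub>R y \<in> ?K" using assms[OF \<omega>] by (intro convexD) auto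
    then have "J ((1/2) *\<^sub>R (x + y)) \<bullet> w \<le> 0" if "w \<in> \<omega>" for w
      using that by (simp add: proj_eq_0_iff[OF C] scaleR_add_right)
    then have "J (x + y) \<bullet> w \<le> 0" if "w \<in> \<omega>" for w using that by (auto simp: J_scale)
    then show ?thesis by (intro in_span_pair_if_orthogonal) (auto simp: \<omega>_def)
  qed
qed

end

theorem theorem7:
  fixes \<sigma> :: "real ^ 'n \<Rightarrow> real"
  assumes "is_norm \<sigma>" and "smooth_norm \<sigma>" and "strictly_convex_norm \<sigma>"
  shows "let
      i = (\<forall>C. closed C \<and> convex_cone C \<longrightarrow>
             mutually_polar_retractions_on_convex_cones (proj \<sigma> C) (coproj \<sigma> C));
      ii = (\<forall>C. closed C \<and> convex_cone C \<longrightarrow> convex {x. proj \<sigma> C x = 0});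
      iii = (\<forall>C. closed C \<and> convex_cone C \<longrightarrow>
               convex_additive_on (range (coproj \<sigma> C)) (proj \<sigma> C));
      iv = (\<forall>\<gamma>. meridian \<sigma> \<gamma> \<longrightarrow> coherent \<sigma> \<gamma>);
      v = (\<forall>\<omega>. minimal_wedge \<omega> \<longrightarrow>
             mutually_polar_retractions_on_convex_cones (proj \<sigma> \<omega>) (coproj \<sigma> \<omega>))
    in (i \<longleftrightarrow> ii) \<and> (i \<longleftrightarrow> iii) \<and> (i \<longleftrightarrow> iv) \<and> (i \<longleftrightarrow> v)"
proof -
  interpret smooth_rotund_norm \<sigma> using assms by unfold_locales
  have kernels: "mutually_polar_retractions_on_convex_cones (proj \<sigma> C) (coproj \<sigma> C)
      \<longleftrightarrow> convex {x. proj \<sigma> C x = 0}"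
    "convex_additive_on (range (coproj \<sigma> C)) (proj \<sigma> C) \<longleftrightarrow> convex {x. proj \<sigma> C x = 0}"
    if "closed C \<and> convex_cone C" for C
    using that polar_on_convex_cones_iff convex_additive_on_range_coproj_iff by blast+
  have wedge: "closed \<omega> \<and> convex_cone \<omega>" if "minimal_wedge \<omega>" for \<omega> :: "(real ^ 'n) set"
    using minimal_wedge_closed_convex_cone[OF that] by blast
  have iv: "(\<forall>C. closed C \<and> convex_cone C \<longrightarrow> convex {x. proj \<sigma> C x = 0}) \<longleftrightarrow> planar"
    using convex_wedge_kernels_imp_planar wedge planar_imp_convex_kernel by meson
  have v: "(\<forall>\<omega>. minimal_wedge \<omega> \<longrightarrow> convex {x. proj \<sigma> \<omega> x = 0}) \<longleftrightarrow> planar"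
    using convex_wedge_kernels_imp_planar wedge planar_imp_convex_kernel by meson
  show ?thesis
    unfolding Let_def coherent_meridians_iff_planar
    using iv v by (simp add: kernels wedge cong: imp_cong)
qed

end
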